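(* Let $Z$ be a scalar instrumental variable, $U$ a scalar unmeasured confounder, $A\in\{0,1\}$ a treatment and $Y$ a real-valued outcome with potential outcomes $Y(1),Y(0)$, following the causal diagram $Z\to A$, $U\to A$, $U\to Y$, $A\to Y$ described in the context. Suppose that (a) $\mathrm{pr}(A=1\mid Z=z)$ is non-decreasing in $z$, $\mathrm{pr}(A=1\mid U=u)$ is non-decreasing in $u$, and $E(Y\mid A=a,U=u)$ is non-decreasing in $u$ for both $a=0$ and $a=1$; (b) $E(Y\mid A=a,Z=z)$ is non-increasing in $z$ for both $a=0$ and $a=1$. Then $$\mathrm{ACE}_1^{\mathrm{adj}}\ge \mathrm{ACE}^{\mathrm{unadj}}\ge \mathrm{ACE}_1^{\mathrm{true}},\qquad \mathrm{ACE}_0^{\mathrm{adj}}\ge \mathrm{ACE}^{\mathrm{unadj}}\ge \mathrm{ACE}_0^{\mathrm{true}},\qquad \mathrm{ACE}^{\mathrm{adj}}\ge \mathrm{ACE}^{\mathrm{unadj}}\ge \mathrm{ACE}^{\mathrm{true}}.$$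
   Context: Setting. On a probability space, $A\in\{0,1\}$ is a binary treatment, $Z$ and $U$ are real-valued random variables, $Y(1),Y(0)$ are real-valued potential outcomes, and $Y=AY(1)+(1-A)Y(0)$. (Everything is conditional on observed covariates, which are suppressed.) The causal diagram is the directed acyclic graph with arrows $Z\to A$, $U\to A$, $U\to Y$, $A\to Y$ and means: $Z$ is independent of $U$; $Z$ is conditionally independent of $Y$ given $(A,U)$; $Z$ and $A$ are not independent; and $A$ is conditionally independent of $Y(a)$ given $U$ for $a=0,1$. True average causal effects: $\mathrm{ACE}_1^{\mathrm{true}}=E\{Y(1)\mid A=1\}-E\{Y(0)\mid A=1\}$, $\mathrm{ACE}_0^{\mathrm{true}}=E\{Y(1)\mid A=0\}-E\{Y(0)\mid A=0\}$, $\mathrm{ACE}^{\mathrm{true}}=E\{Y(1)\}-E\{Y(0)\}$. Unadjusted estimator: $\mathrm{ACE}^{\mathrm{unadj}}=E(Y\mid A=1)-E(Y\mid A=0)$. Adjusted estimators, with $\mu_a(z)=E(Y\mid A=a,Z=z)$ and $F$ denoting distributions: $\mathrm{ACE}_1^{\mathrm{adj}}=E(Y\mid A=1)-\int\mu_0(z)\,F(dz\mid A=1)$, $\mathrm{ACE}_0^{\mathrm{adj}}=\int\mu_1(z)\,F(dz\mid A=0)-E(Y\mid A=0)$, $\mathrm{ACE}^{\mathrm{adj}}=\int\mu_1(z)\,F(dz)-\int\mu_0(z)\,F(dz)$. Conventions: all expectations appearing are assumed to exist and be finite, and all conditional quantities are assumed well defined (in particular $0<\mathrm{pr}(A=1\mid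 Z)<1$ and $0<\mathrm{pr}(A=1\mid U)<1$ almost surely); monotonicity of a conditional expectation in a conditioning value means that it has a version with that monotonicity. *)

theory Defs
  imports "HOL-Probability.Probability"
begin

definition sigma_of :: "'w measure \<Rightarrow> ('w \<Rightarrow> 'b::topological_space) \<Rightarrow> 'w measure" where
  "sigma_of M W = vimage_algebra (space M) W borel"

text \<open>\<open>g\<close> is a version of \<open>w \<mapsto> E(X | W = w)\<close>.\<close>

definition cond_exp_version ::
    "'w measure \<Rightarrow> ('w \<Rightarrow> real) \<Rightarrow> ('w \<Rightarrow> 'b::topological_space) \<Rightarrow> ('b \<Rightarrow> real) \<Rightarrow> bool" where
  "cond_exp_version M X W g \<longleftrightarrow>
     g \<in> borel_measurable borel \<and>
     (AE \<omega> in M. g (W \<omega>) = real_cond_exp M (sigma_of M W) X \<omega>)"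

definition cond_indep_var ::
    "'w measure \<Rightarrow> ('w \<Rightarrow> real) \<Rightarrow> ('w \<Rightarrow> real) \<Rightarrow> ('w \<Rightarrow> 'b::topological_space) \<Rightarrow> bool" where
  "cond_indep_var M X Y W \<longleftrightarrow>
     X \<in> borel_measurable M \<and> Y \<in> borel_measurable M \<and> W \<in> measurable M borel \<and>
     (\<forall>B\<in>sets borel. \<forall>C\<in>sets borel. AE \<omega> in M.
        real_cond_exp M (sigma_of M W) (indicator {\<omega> \<in> space M. X \<omega> \<in> B \<and> Y \<omega> \<in> C}) \<omega> =
        real_cond_exp M (sigma_of M W) (indicator {\<omega> \<in> space M. X \<omega> \<in> B}) \<omega> *
        real_cond_exp M (sigma_of M W) (indicator {\<omega> \<in> space M. Y \<omega> \<in> C}) \<omega>)"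

text \<open>A version of a conditional expectation matters only up to null sets of the law of the
  conditioning variable \<open>W\<close>, so monotonicity is required on a set of values that \<open>W\<close> takes almost
  surely. Requiring it on the whole line would exclude, e.g., a version that is increasing and
  unbounded on \<open>(0,1)\<close> when \<open>W\<close> is uniform on \<open>(0,1)\<close>.\<close>

definition nondecreasing_in :: "'w measure \<Rightarrow> ('w \<Rightarrow> real) \<Rightarrow> (real \<Rightarrow> real) \<Rightarrow> bool" where
  "nondecreasing_in M W g \<longleftrightarrow> (\<exists>S. (AE \<omega> in M. W \<omega> \<in> S) \<and> mono_on S g)"

definition nonincreasing_in :: "'w measure \<Rightarrow> ('w \<Rightarrow> real) \<Rightarrow> (real \<Rightarrow> real) \<Rightarrow> bool" where
  "nonincreasing_in M W g \<longleftrightarrow> (\<exists>S. (AE \<omega> in M. W \<omega> \<in> S) \<and> antimono_on S g)"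

definition treated :: "'w measure \<Rightarrow> ('w \<Rightarrow> real) \<Rightarrow> 'w \<Rightarrow> real" where
  "treated M A = indicator {\<omega> \<in> space M. A \<omega> = 1}"

text \<open>The conditional probability measure given \<open>A = a\<close>, and \<open>E(X | A = a)\<close>.\<close>

definition given :: "'w measure \<Rightarrow> ('w \<Rightarrow> real) \<Rightarrow> real \<Rightarrow> 'w measure" where
  "given M A a = uniform_measure M {\<omega> \<in> space M. A \<omega> = a}"

definition mean_given :: "'w measure \<Rightarrow> ('w \<Rightarrow> real) \<Rightarrow> real \<Rightarrow> ('w \<Rightarrow> real) \<Rightarrow> real" where
  "mean_given M A a X = (\<integral>\<omega>. X \<omega> \<partial>given M A a)"

definition ACE1_true where
  "ACE1_true M A Y1 Y0 = mean_given M A 1 Y1 - mean_given M A 1 Y0"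

definition ACE0_true where
  "ACE0_true M A Y1 Y0 = mean_given M A 0 Y1 - mean_given M A 0 Y0"

definition ACE_true :: "'w measure \<Rightarrow> ('w \<Rightarrow> real) \<Rightarrow> ('w \<Rightarrow> real) \<Rightarrow> real" where
  "ACE_true M Y1 Y0 = (\<integral>\<omega>. Y1 \<omega> \<partial>M) - (\<integral>\<omega>. Y0 \<omega> \<partial>M)"

definition ACE_unadj where
  "ACE_unadj M A Y = mean_given M A 1 Y - mean_given M A 0 Y"

text \<open>In the adjusted estimators, \<open>\<mu> a z\<close> stands for \<open>E(Y | A = a, Z = z)\<close>.\<close>

definition ACE1_adj where
  "ACE1_adj M A Z Y \<mu> = mean_given M A 1 Y - (\<integral>z. \<mu> 0 z \<partial>distr (given M A 1) borel Z)"

definition ACE0_adj where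
  "ACE0_adj M A Z Y \<mu> = (\<integral>z. \<mu> 1 z \<partial>distr (given M A 0) borel Z) - mean_given M A 0 Y"

definition ACE_adj ::
    "'w measure \<Rightarrow> ('w \<Rightarrow> real) \<Rightarrow> (real \<Rightarrow> real \<Rightarrow> real) \<Rightarrow> real" where
  "ACE_adj M Z \<mu> = (\<integral>z. \<mu> 1 z \<partial>distr M borel Z) - (\<integral>z. \<mu> 0 z \<partial>distr M borel Z)"

end

theory Submission
  imports Defs
begin

text \<open>Both inequalities of each pair compare \<open>E(X | A = 1)\<close> with \<open>E(X | A = 0)\<close>, hence amount to a sign
  of the covariance of \<open>A\<close> and \<open>X\<close>, for \<open>X = Y(a)\<close> and for \<open>X = \<mu>\<^sub>a(Z)\<close>. Conditioning on \<open>W = U\<close> or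
  \<open>W = Z\<close> turns it into the covariance of two monotone functions of \<open>W\<close>, the propensity
  \<open>pr(A = 1 | W)\<close> and \<open>E(X | W)\<close>, and Chebyshev's association inequality applies. The overlap
  condition is what identifies \<open>E(Y(a) | U)\<close> with \<open>E(Y | A = a, U)\<close>, and \<open>\<mu>\<^sub>a(Z)\<close> with the monotone
  version, almost surely.\<close>

context prob_space
begin

section \<open>Chebyshev's association inequality for comonotone functions\<close>

lemma expectation_mult_ge_if_comonotone:
  fixes f g :: "'a \<Rightarrow> real"
  assumes f: "integrable M f" and g: "integrable M g" and fg: "integrable M (\<lambda>x. f x * g x)"
    and T: "AE x in M. x \<in> T"
    and comono: "\<And>x y. x \<in> T \<Longrightarrow> y \<in> T \<Longrightarrow> f x < f y \<Longrightarrow> g x \<le> g y"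
  shows "expectation f * expectation g \<le> expectation (\<lambda>x. f x * g x)"
  \<comment> \<open>Comonotonicity provides a constant \<open>k\<close> separating the values of \<open>g\<close> on \<open>{f < E f}\<close> from those on
    \<open>{f > E f}\<close>, so that \<open>(f - E f) (g - k)\<close> is nonnegative; no product measure is needed.\<close>
proof -
  define c where "c = expectation f"
  have c: "expectation (\<lambda>x. f x - c) = 0" "expectation (\<lambda>x. c - f x) = 0"
    using f by (simp_all add: c_def prob_space)
  have int: "integrable M (\<lambda>x. (f x - c) * (g x - k))" for k
    using f g fg by (simp add: algebra_simps)
  \<comment> \<open>Since \<open>f - c\<close> has mean zero, this integral is the covariance of
    \<open>f\<close> and \<open>g\<close> for every \<open>k\<close>, so \<open>k\<close> can be
    chosen freely below.\<close>
  have eq: "expectation (\<lambda>x. (f x - c) * (g x - k)) =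
      expectation (\<lambda>x. f x * g x) - c * expectation g" for k
  proof -
    have "expectation (\<lambda>x. (f x - c) * (g x - k)) =
        expectation (\<lambda>x. f x * g x - c * g x - k * (f x - c))"
      by (simp add: algebra_simps)
    also have "\<dots> = expectation (\<lambda>x. f x * g x) - c * expectation g"
      using f g fg c(1) by simp
    finally show ?thesis .
  qed
  define L where "L = {x \<in> T. f x < c}"
  define H where "H = {x \<in> T. f x > c}"
  have "\<exists>k. AE x in M. 0 \<le> (f x - c) * (g x - k)"
  proof (cases "L = {} \<or> H = {}")
    \<comment> \<open>Here \<open>f - c\<close> has constant sign almost everywhere and mean zero,
      hence vanishes almost everywhere, and any \<open>k\<close> will do.\<close>
    case True
    have "AE x in M. f x - c = 0"
    proof (cases "L = {}")
      case True
      have "AE x in M. 0 \<le> f x - c"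
        using T by eventually_elim (use True in \<open>auto simp: L_def not_less\<close>)
      then show ?thesis
        using integral_nonneg_eq_0_iff_AE[of M "\<lambda>x. f x - c"] f c by simp
    next
      case False
      with True have "H = {}" by simp
      have "AE x in M. 0 \<le> c - f x"
        using T by eventually_elim (use \<open>H = {}\<close> in \<open>auto simp: H_def not_less\<close>)
      then have "AE x in M. c - f x = 0"
        using integral_nonneg_eq_0_iff_AE[of M "\<lambda>x. c - f x"] f c by simp
      then show ?thesis by eventually_elim simp
    qed
    then have "AE x in M. 0 \<le> (f x - c) * (g x - 0)" by eventually_elim simp
    then show ?thesis by blast
  next
    case False
    have LH: "g x \<le> g y" if "x \<in> L" "y \<in> H" for x y
      using that comono[of x y] by (auto simp: L_def H_def)
    \<comment> \<open>A point of \<open>H\<close> bounds \<open>g\<close> on \<open>L\<close>, so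
      the supremum of \<open>g\<close> over \<open>L\<close> can serve as \<open>k\<close>: it is at
      least \<open>g\<close> on \<open>L\<close> and, \<open>L\<close> being nonempty, at most
      \<open>g\<close> on \<open>H\<close>. Points with \<open>f x = c\<close> contribute
      zero.\<close>
    have bdd: "bdd_above (g ` L)" using False LH unfolding bdd_above_def by blast
    have "AE x in M. 0 \<le> (f x - c) * (g x - Sup (g ` L))"
      using T
    proof eventually_elim
      case (elim x)
      show ?case
      proof (cases "f x" c rule: linorder_cases)
        case less
        then have "g x \<le> Sup (g ` L)"
          using elim bdd by (intro cSup_upper) (auto simp: L_def)
        with less show ?thesis by (simp add: mult_nonpos_nonpos)
      next
        case greater
        then have "Sup (g ` L) \<le> g x"
          using elim LH False by (intro cSup_least) (auto simp: H_def)
        with greater show ?thesis by simp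
      qed simp
    qed
    then show ?thesis by blast
  qed
  then obtain k where "AE x in M. 0 \<le> (f x - c) * (g x - k)" by blast
  then have "0 \<le> expectation (\<lambda>x. (f x - c) * (g x - k))"
    by (rule integral_nonneg_AE)
  then show ?thesis unfolding c_def[symmetric] using eq[of k] by linarith
qed

section \<open>Conditioning on a random variable, and factorisation under conditional
  independence\<close>

lemma finite_measure_subalgebra_sigma_of:
  assumes "W \<in> borel_measurable M"
  shows "finite_measure_subalgebra M (sigma_of M W)"
  using assms unfolding sigma_of_def finite_measure_subalgebra_def finite_measure_subalgebra_axioms_def
  by (auto intro!: finite_measure_axioms simp: subalgebra_def sets_vimage_algebra2 measurable_sets)

lemma measurable_sigma_of: "W \<in> borel_measurable (sigma_of M W)"
  unfolding sigma_of_def by (rule measurable_vimage_algebra1) auto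

lemma real_cond_exp_indicator_bounds:
  assumes "finite_measure_subalgebra M F" "S \<in> sets M"
  shows "AE x in M. 0 \<le> real_cond_exp M F (indicator S) x \<and> real_cond_exp M F (indicator S) x \<le> 1"
proof -
  interpret finite_measure_subalgebra M F by fact
  have "AE x in M. real_cond_exp M F (indicator S) x \<ge> 0"
    using assms by (intro real_cond_exp_ge_c) (auto simp: less_top[symmetric])
  moreover have "AE x in M. real_cond_exp M F (indicator S) x \<le> 1"
    using assms by (intro real_cond_exp_le_c) (auto simp: less_top[symmetric])
  ultimately show ?thesis by eventually_elim simp
qed

lemma integrable_real_cond_exp_indicator_mult:
  assumes "finite_measure_subalgebra M F" "S \<in> sets M" "integrable M V"
  shows "integrable M (\<lambda>x. real_cond_exp M F (indicator S) x * V x)"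
proof (rule Bochner_Integration.integrable_bound[OF assms(3)])
  show "(\<lambda>x. real_cond_exp M F (indicator S) x * V x) \<in> borel_measurable M"
    using borel_measurable_cond_exp2 assms(3) by measurable
  show "AE x in M. norm (real_cond_exp M F (indicator S) x * V x) \<le> norm (V x)"
    using real_cond_exp_indicator_bounds[OF assms(1,2)]
    by eventually_elim (auto simp: abs_mult intro!: mult_left_le_one_le)
qed

text \<open>Conditional independence is only assumed for events. For a fixed event \<open>D\<close> of the conditioning
  \<open>\<sigma>\<close>-algebra, it says that the law of \<open>V\<close> under the measures with densities \<open>1\<^sub>D 1\<^sub>S\<close> and
  \<open>1\<^sub>D P(S | W)\<close> is the same, and integrating the identity yields the statement for \<open>V\<close> itself.\<close>

lemma cond_indep_var_real_cond_exp_mult: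
  assumes ind: "cond_indep_var M X V W" and V: "integrable M V" and B: "B \<in> sets borel"
  defines "S \<equiv> {x \<in> space M. X x \<in> B}"
  shows "AE x in M. real_cond_exp M (sigma_of M W) (\<lambda>x. indicator S x * V x) x =
    real_cond_exp M (sigma_of M W) (indicator S) x * real_cond_exp M (sigma_of M W) V x"
proof -
  let ?F = "sigma_of M W"
  define q where "q = real_cond_exp M ?F (indicator S)"
  have [measurable]: "X \<in> borel_measurable M" "V \<in> borel_measurable M" "W \<in> borel_measurable M"
    and ind': "\<And>C. C \<in> sets borel \<Longrightarrow> AE x in M.
        real_cond_exp M ?F (indicator {x \<in> space M. X x \<in> B \<and> V x \<in> C}) x =
        q x * real_cond_exp M ?F (indicator {x \<in> space M. V x \<in> C}) x"
    using ind B by (auto simp: cond_indep_var_def q_def S_def)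
  have S[measurable]: "S \<in> sets M" using B by (simp add: S_def)
  have F: "finite_measure_subalgebra M ?F" by (rule finite_measure_subalgebra_sigma_of) fact
  interpret F: finite_measure_subalgebra M ?F by fact
  have qF[measurable]: "q \<in> borel_measurable ?F" and [measurable]: "q \<in> borel_measurable M"
    by (simp_all add: q_def)
  have q: "AE x in M. 0 \<le> q x \<and> q x \<le> 1"
    using real_cond_exp_indicator_bounds[OF F S] by (simp add: q_def)
  have qV: "integrable M (\<lambda>x. q x * V x)"
    using integrable_real_cond_exp_indicator_mult[OF F S V] by (simp add: q_def)
  have SV: "integrable M (\<lambda>x. indicator S x * V x)"
    using integrable_real_mult_indicator[OF S V] by (simp add: mult.commute)
  have "AE x in M. real_cond_exp M ?F (\<lambda>x. indicator S x * V x) x = q x * real_cond_exp M ?F V x"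
  proof (rule F.real_cond_exp_charact)
    fix D assume D: "D \<in> sets ?F"
    have D'[measurable]: "D \<in> sets M" using D F.subalg by (auto simp: subalgebra_def)
    define f1 :: "'a \<Rightarrow> real" where "f1 = (\<lambda>x. indicator D x * indicator S x)"
    define f2 where "f2 = (\<lambda>x. indicator D x * q x)"
    have [measurable]: "f1 \<in> borel_measurable M" "f2 \<in> borel_measurable M"
      unfolding f1_def f2_def by measurable
    have f1: "AE x in M. 0 \<le> f1 x" by (simp add: f1_def)
    have f2: "AE x in M. 0 \<le> f2 x" using q by eventually_elim (simp add: f2_def)
    have int2: "integrable M f2"
    proof (rule Bochner_Integration.integrable_bound[of M "\<lambda>_. 1 :: real"])
      show "AE x in M. norm (f2 x) \<le> norm (1 :: real)"
        using q by eventually_elim (auto simp: f2_def indicator_def)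
    qed simp_all
    have f2C: "integrable M (\<lambda>x. f2 x * indicator C x)" if "C \<in> sets M" for C
      using integrable_real_mult_indicator[OF that int2] .
    have law: "distr (density M f1) borel V = distr (density M f2) borel V"
    proof (rule measure_eqI)
      fix C assume "C \<in> sets (distr (density M f1) borel V)"
      then have C[measurable]: "C \<in> sets borel" by simp
      define VC where "VC = {x \<in> space M. V x \<in> C}"
      have [measurable]: "VC \<in> sets M" by (simp add: VC_def)
      have em: "emeasure (distr (density M f) borel V) C = ennreal (\<integral>x. f x * indicator VC x \<partial>M)"
        if [measurable]: "f \<in> borel_measurable M" and f: "AE x in M. 0 \<le> f x"
          "integrable M (\<lambda>x. f x * indicator VC x)" for f
      proof -
        have "emeasure (distr (density M f) borel V) C = (\<integral>\<^sup>+x. ennreal (f x) * indicator VC x \<partial>M)"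
          by (simp add: emeasure_distr emeasure_density VC_def vimage_def Int_def conj_commute)
        also have "\<dots> = (\<integral>\<^sup>+x. ennreal (f x * indicator VC x) \<partial>M)"
          by (intro nn_integral_cong) (auto simp: indicator_def)
        also have "\<dots> = ennreal (\<integral>x. f x * indicator VC x \<partial>M)"
          using f by (intro nn_integral_eq_integral) auto
        finally show ?thesis .
      qed
      have inter: "indicator S x * indicator VC x = (indicator {x \<in> space M. X x \<in> B \<and> V x \<in> C} x :: real)" for x
        by (auto simp: indicator_def S_def VC_def)
      have SC[measurable]: "{x \<in> space M. X x \<in> B \<and> V x \<in> C} \<in> sets M"
        using B by measurable
      have D_SC: "integrable M (\<lambda>x. indicator D x * indicator {x \<in> space M. X x \<in> B \<and> V x \<in> C} x :: real)"
        by (rule Bochner_Integration.integrable_bound[of M "\<lambda>_. 1 :: real"]) (auto simp: indicator_def)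
      have int1: "integrable M f1"
        by (rule Bochner_Integration.integrable_bound[of M "\<lambda>_. 1 :: real"]) (auto simp: f1_def indicator_def)
      have DF: "(indicator D :: 'a \<Rightarrow> real) \<in> borel_measurable ?F" using D by simp
      \<comment> \<open>Condition on \<open>?F\<close>, which is possible as
        \<open>indicator D\<close> is \<open>?F\<close>-measurable, factorise by
        \<open>ind'\<close>, and undo the conditioning of \<open>VC\<close> against the weight
        \<open>f2\<close>, which is \<open>?F\<close>-measurable too.\<close>
      have "(\<integral>x. f1 x * indicator VC x \<partial>M) =
          (\<integral>x. indicator D x * indicator {x \<in> space M. X x \<in> B \<and> V x \<in> C} x \<partial>M)"
        by (simp add: f1_def mult.assoc inter)
      also have "\<dots> = (\<integral>x. indicator D x * real_cond_exp M ?F (indicator {x \<in> space M. X x \<in> B \<and> V x \<in> C}) x \<partial>M)"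
        using DF D_SC by (intro F.real_cond_exp_intg(2)[symmetric]) simp_all
      also have "\<dots> = (\<integral>x. f2 x * real_cond_exp M ?F (indicator VC) x \<partial>M)"
        using ind'[OF C] by (intro integral_cong_AE) (auto simp: f2_def VC_def mult.assoc)
      also have "\<dots> = (\<integral>x. f2 x * indicator VC x \<partial>M)"
        using DF f2C by (intro F.real_cond_exp_intg(2)) (auto simp: f2_def)
      finally show "emeasure (distr (density M f1) borel V) C = emeasure (distr (density M f2) borel V) C"
        using f1 f2 int1 f2C by (simp add: em integrable_real_mult_indicator)
    qed simp
    have "(\<integral>x. f1 x * V x \<partial>M) = (\<integral>y. y \<partial>distr (density M f1) borel V)"
      by (simp add: integral_distr integral_density f1)
    also have "\<dots> = (\<integral>x. f2 x * V x \<partial>M)"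
      unfolding law by (simp add: integral_distr integral_density f2)
    also have "\<dots> = (\<integral>x. f2 x * real_cond_exp M ?F V x \<partial>M)"
      using D integrable_real_mult_indicator[OF D' qV]
      by (intro F.real_cond_exp_intg(2)[symmetric]) (auto simp: f2_def mult_ac)
    finally show "(LINT x:D|M. indicator S x * V x) = (LINT x:D|M. q x * real_cond_exp M ?F V x)"
      by (simp add: set_lebesgue_integral_def f1_def f2_def mult.assoc)
  next
    show "integrable M (\<lambda>x. q x * real_cond_exp M ?F V x)"
      using qV by (intro F.real_cond_exp_intg(1)) auto
  qed (use SV in auto)
  then show ?thesis by (simp add: q_def)
qed

section \<open>Conditional means within a stratum \<open>A = a\<close>\<close>

lemma cond_exp_version_stratum_measurable:
  assumes "cond_exp_version M Y (\<lambda>x. (A x, W x)) (\<lambda>(a :: real, w :: real). m a w)"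
  shows "m a \<in> borel_measurable borel"
proof -
  have "(\<lambda>(a, w). m a w) \<in> borel_measurable (borel \<Otimes>\<^sub>M borel)"
    using assms by (simp only: cond_exp_version_def borel_prod)
  from measurable_Pair2[OF this, of a] show ?thesis by simp
qed

text \<open>The event \<open>S\<close> lies in the sigma-algebra of \<open>(A, W)\<close>, and on it
  the version of E(Y | A, W) reads \<open>m a (W x)\<close>; the tower property down to
  \<open>W\<close> gives the last claim. Where the conditional probability of \<open>S\<close> is
  positive, that claim determines \<open>m a (W x)\<close> almost surely on the whole space, not
  just on \<open>S\<close>.\<close>

lemma real_cond_exp_stratum:
  fixes a :: real
  assumes A: "A \<in> borel_measurable M" and W: "W \<in> borel_measurable M" and Y: "integrable M Y"
    and m: "cond_exp_version M Y (\<lambda>x. (A x, W x :: real)) (\<lambda>(a, w). m a w)"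
  defines "S \<equiv> {x \<in> space M. A x = a}"
  shows "integrable M (\<lambda>x. indicator S x * m a (W x))"
    and "expectation (\<lambda>x. indicator S x * Y x) = expectation (\<lambda>x. indicator S x * m a (W x))"
    and "AE x in M. real_cond_exp M (sigma_of M W) (\<lambda>x. indicator S x * Y x) x =
      m a (W x) * real_cond_exp M (sigma_of M W) (indicator S) x"
proof -
  note [measurable] = A W
  have AW[measurable]: "(\<lambda>x. (A x, W x)) \<in> borel_measurable M" by simp
  let ?F = "sigma_of M W" and ?G = "sigma_of M (\<lambda>x. (A x, W x))"
  interpret F: finite_measure_subalgebra M ?F by (rule finite_measure_subalgebra_sigma_of) fact
  interpret G: finite_measure_subalgebra M ?G by (rule finite_measure_subalgebra_sigma_of) fact
  have [measurable]: "(\<lambda>(a, w). m a w) \<in> borel_measurable borel"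
    and ver: "AE x in M. m (A x) (W x) = real_cond_exp M ?G Y x"
    using m by (auto simp: cond_exp_version_def)
  have ma: "m a \<in> borel_measurable borel" by (rule cond_exp_version_stratum_measurable[OF m])
  note [measurable] = ma
  have AWG: "(\<lambda>x. (A x, W x)) \<in> ?G \<rightarrow>\<^sub>M borel \<Otimes>\<^sub>M borel"
    using measurable_sigma_of[of "\<lambda>x. (A x, W x)"] by (simp only: borel_prod)
  have AG: "A \<in> borel_measurable ?G" and WG: "W \<in> borel_measurable ?G"
    using measurable_compose[OF AWG measurable_fst] measurable_compose[OF AWG measurable_snd]
    by simp_all
  have sp: "space ?G = space M" "space ?F = space M" by (simp_all add: sigma_of_def)
  have S[measurable]: "S \<in> sets M" by (simp add: S_def)
  have SG: "S \<in> sets ?G"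
    using measurable_sets[OF AG, of "{a}"] by (simp add: S_def vimage_def Int_def sp conj_commute)
  have GF: "subalgebra ?G ?F"
    unfolding subalgebra_def sp using WG
    by (auto simp: sigma_of_def sets_vimage_algebra2 measurable_sets sp dest!: measurable_sets)
  have SY: "integrable M (\<lambda>x. indicator S x * Y x)"
    using integrable_real_mult_indicator[OF S Y] by (simp add: mult.commute)
  have "AE x in M. real_cond_exp M ?G (\<lambda>x. indicator S x * Y x) x = indicator S x * real_cond_exp M ?G Y x"
    using SG Y SY by (intro G.real_cond_exp_mult) auto
  \<comment> \<open>\<open>ver\<close> concerns \<open>m (A x) (W x)\<close>: on \<open>S\<close>
    the first argument is \<open>a\<close>, and off \<open>S\<close> both sides vanish.\<close>
  with ver have eq: "AE x in M. real_cond_exp M ?G (\<lambda>x. indicator S x * Y x) x = indicator S x * m a (W x)"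
    by eventually_elim (auto simp: S_def indicator_def)
  show int: "integrable M (\<lambda>x. indicator S x * m a (W x))"
    using integrable_cong_AE_imp[OF G.real_cond_exp_int(1)[OF SY] _ eq] by simp
  show "expectation (\<lambda>x. indicator S x * Y x) = expectation (\<lambda>x. indicator S x * m a (W x))"
    using G.real_cond_exp_int(2)[OF SY] integral_cong_AE[OF _ _ eq] by simp
  have "AE x in M. real_cond_exp M ?F (\<lambda>x. indicator S x * Y x) x =
      real_cond_exp M ?F (real_cond_exp M ?G (\<lambda>x. indicator S x * Y x)) x"
    using F.real_cond_exp_nested_subalg[OF G.subalg GF SY] by (rule AE_symmetric)
  moreover have "AE x in M. real_cond_exp M ?F (real_cond_exp M ?G (\<lambda>x. indicator S x * Y x)) x =
      real_cond_exp M ?F (\<lambda>x. m a (W x) * indicator S x) x"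
    using eq by (intro F.real_cond_exp_cong) (auto simp: mult.commute)
  moreover have "AE x in M. real_cond_exp M ?F (\<lambda>x. m a (W x) * indicator S x) x =
      m a (W x) * real_cond_exp M ?F (indicator S) x"
    using int measurable_compose[OF measurable_sigma_of ma]
    by (intro F.real_cond_exp_mult) (auto simp: mult.commute)
  ultimately show "AE x in M. real_cond_exp M ?F (\<lambda>x. indicator S x * Y x) x =
      m a (W x) * real_cond_exp M ?F (indicator S) x"
    by eventually_elim simp
qed

section \<open>Consequences of the overlap condition\<close>

text \<open>The conditional probability integrates to \<open>prob S\<close>; if that were zero, it
  would vanish almost everywhere. This makes the denominators of both stratum means
  positive.\<close>

lemma prob_pos_if_real_cond_exp_pos:
  assumes F: "finite_measure_subalgebra M F" and S: "S \<in> sets M"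
    and pos: "AE x in M. 0 < real_cond_exp M F (indicator S) x"
  shows "0 < prob S"
proof (rule ccontr)
  interpret F: finite_measure_subalgebra M F by fact
  have int: "integrable M (indicator S :: 'a \<Rightarrow> real)" using S by (simp add: less_top[symmetric])
  assume "\<not> 0 < prob S"
  then have "expectation (real_cond_exp M F (indicator S)) = 0"
    using F.real_cond_exp_int(2)[OF int] S measure_nonneg[of M S] by simp
  moreover have "AE x in M. 0 \<le> real_cond_exp M F (indicator S) x"
    using pos by eventually_elim simp
  ultimately have "AE x in M. real_cond_exp M F (indicator S) x = 0"
    using integral_nonneg_eq_0_iff_AE[OF F.real_cond_exp_int(1)[OF int]] by simp
  with pos have "AE x in M. False" by eventually_elim simp
  then show False by simp
qed

text \<open>Linearity of conditional expectation; this carries overlap over from the treated to the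
  untreated stratum.\<close>

lemma real_cond_exp_compl_pos:
  assumes F: "finite_measure_subalgebra M F" and S: "S \<in> sets M"
    and less: "AE x in M. real_cond_exp M F (indicator S) x < 1"
  shows "AE x in M. 0 < real_cond_exp M F (indicator (space M - S)) x"
proof -
  interpret F: finite_measure_subalgebra M F by fact
  have "AE x in M. real_cond_exp M F (\<lambda>x. 1 - indicator S x) x =
      real_cond_exp M F (\<lambda>_. 1) x - real_cond_exp M F (indicator S) x"
    using S by (intro F.real_cond_exp_diff) (auto simp: less_top[symmetric])
  moreover have "AE x in M. real_cond_exp M F (\<lambda>_. 1) x = 1"
    by (intro F.real_cond_exp_F_meas) auto
  moreover have "AE x in M. real_cond_exp M F (indicator (space M - S)) x =
      real_cond_exp M F (\<lambda>x. 1 - indicator S x) x"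
    using S by (intro F.real_cond_exp_cong) (auto simp: indicator_def)
  ultimately show ?thesis using less by eventually_elim simp
qed

section \<open>The sign of the covariance of treatment and a variable\<close>

text \<open>By \<open>fact\<close> the conditional covariance given \<open>W\<close> is zero, so the
  covariance of \<open>indicator S\<close> and \<open>X\<close> is that of \<open>p (W x)\<close>
  and \<open>g (W x)\<close>. The factorisation is a hypothesis because it has two sources:
  conditional independence for \<open>W = U\<close>, and measurability of \<open>X\<close> for
  \<open>W = Z\<close>.\<close>

lemma prob_mult_expectation_le:
  assumes W: "W \<in> borel_measurable M" and S: "S \<in> sets M" and X: "integrable M X"
    and fact: "AE x in M. real_cond_exp M (sigma_of M W) (\<lambda>x. indicator S x * X x) x =
      real_cond_exp M (sigma_of M W) (indicator S) x * real_cond_exp M (sigma_of M W) X x"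
    and p: "cond_exp_version M (indicator S) W p" "nondecreasing_in M W p"
    and g: "cond_exp_version M X W g" "nondecreasing_in M W g"
  shows "prob S * expectation X \<le> expectation (\<lambda>x. indicator S x * X x)"
proof -
  let ?F = "sigma_of M W"
  interpret F: finite_measure_subalgebra M ?F by (rule finite_measure_subalgebra_sigma_of) fact
  note [measurable] = W
  have [measurable]: "p \<in> borel_measurable borel" "g \<in> borel_measurable borel"
    and p_eq: "AE x in M. real_cond_exp M ?F (indicator S) x = p (W x)"
    and g_eq: "AE x in M. real_cond_exp M ?F X x = g (W x)"
    using p(1) g(1) by (auto simp: cond_exp_version_def intro: AE_symmetric)
  have intS: "integrable M (indicator S :: 'a \<Rightarrow> real)" using S by (simp add: less_top[symmetric])
  have SX: "integrable M (\<lambda>x. indicator S x * X x)"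
    using integrable_real_mult_indicator[OF S X] by (simp add: mult.commute)
  have eq: "AE x in M. real_cond_exp M ?F (\<lambda>x. indicator S x * X x) x = p (W x) * g (W x)"
    using fact p_eq g_eq by eventually_elim simp
  have int: "integrable M (\<lambda>x. p (W x))" "integrable M (\<lambda>x. g (W x))"
      "integrable M (\<lambda>x. p (W x) * g (W x))"
    using integrable_cong_AE_imp[OF F.real_cond_exp_int(1)[OF intS] _ p_eq]
      integrable_cong_AE_imp[OF F.real_cond_exp_int(1)[OF X] _ g_eq]
      integrable_cong_AE_imp[OF F.real_cond_exp_int(1)[OF SX] _ eq]
    by simp_all
  obtain P G where P: "AE x in M. W x \<in> P" "mono_on P p" and G: "AE x in M. W x \<in> G" "mono_on G g"
    using p(2) g(2) by (auto simp: nondecreasing_in_def)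
  have "expectation (\<lambda>x. p (W x)) * expectation (\<lambda>x. g (W x)) \<le> expectation (\<lambda>x. p (W x) * g (W x))"
  \<comment> \<open>\<open>p\<close> and \<open>g\<close> may be monotone on different sets of full
    measure, hence the intersection. Strict increase of \<open>p\<close> excludes
    \<open>W y \<le> W x\<close>, which orders the arguments of \<open>g\<close>.\<close>
  proof (rule expectation_mult_ge_if_comonotone[where T = "{x. W x \<in> P \<inter> G}"])
    show "AE x in M. x \<in> {x. W x \<in> P \<inter> G}" using P(1) G(1) by eventually_elim simp
    fix x y assume xy: "x \<in> {x. W x \<in> P \<inter> G}" "y \<in> {x. W x \<in> P \<inter> G}" "p (W x) < p (W y)"
    then have "W x \<le> W y"
      using mono_onD[OF P(2), of "W y" "W x"] by (force simp: not_le[symmetric])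
    then show "g (W x) \<le> g (W y)" using mono_onD[OF G(2)] xy by simp
  qed (fact int)+
  moreover have "expectation (\<lambda>x. p (W x)) = prob S"
    using F.real_cond_exp_int(2)[OF intS] integral_cong_AE[OF _ _ p_eq] S by simp
  moreover have "expectation (\<lambda>x. g (W x)) = expectation X"
    using F.real_cond_exp_int(2)[OF X] integral_cong_AE[OF _ _ g_eq] by simp
  moreover have "expectation (\<lambda>x. p (W x) * g (W x)) = expectation (\<lambda>x. indicator S x * X x)"
    using F.real_cond_exp_int(2)[OF SX] integral_cong_AE[OF _ _ eq] by simp
  ultimately show ?thesis by simp
qed

section \<open>Means given the treatment as ratios of integrals\<close>

lemma mean_given_eq:
  assumes [measurable]: "A \<in> borel_measurable M" "X \<in> borel_measurable M"
  shows "mean_given M A a X =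
    expectation (\<lambda>x. indicator {x \<in> space M. A x = a} x * X x) / prob {x \<in> space M. A x = a}"
proof (cases "prob {x \<in> space M. A x = a} = 0")
  \<comment> \<open>Both sides are 0: the uniform measure on a null set is the zero measure, and
    division by zero yields 0.\<close>
  case True
  have "AE x in M. x \<notin> {x \<in> space M. A x = a}"
    using True by (intro AE_not_in) (simp add: null_sets_def emeasure_eq_measure)
  then have "AE x in uniform_measure M {x \<in> space M. A x = a}. X x = 0"
    unfolding uniform_measure_def by (subst AE_density) (auto elim!: eventually_mono)
  then have "mean_given M A a X = 0"
    unfolding mean_given_def given_def by (subst integral_cong_AE[where g = "\<lambda>_. 0"]) simp_all
  with True show ?thesis by simp
next
  case False
  define S where "S = {x \<in> space M. A x = a}"
  have [measurable]: "S \<in> sets M" by (simp add: S_def)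
  have pos: "0 < prob S" using False measure_nonneg[of M S] by (simp add: S_def less_le)
  have "uniform_measure M S = density M (\<lambda>x. ennreal (indicator S x / prob S))"
    unfolding uniform_measure_def using pos
    by (intro density_cong) (auto simp: emeasure_eq_measure indicator_def divide_ennreal[symmetric])
  then have "mean_given M A a X = expectation (\<lambda>x. indicator S x / prob S * X x)"
    by (simp add: mean_given_def given_def S_def integral_density)
  then show ?thesis by (simp add: S_def)
qed

text \<open>The overall mean is the average of the two stratum means weighted by the stratum
  probabilities, so it lies between them, and the sign of the covariance decides their
  order.\<close>

lemma mean_given_le_expectation_le_mean_given:
  assumes A[measurable]: "A \<in> borel_measurable M" and bin: "\<And>x. x \<in> space M \<Longrightarrow> A x \<in> {0, 1 :: real}"
    and X: "integrable M X"
    and pos: "\<And>a. a \<in> {0, 1} \<Longrightarrow> 0 < prob {x \<in> space M. A x = a}"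
    and le: "prob {x \<in> space M. A x = 1} * expectation X \<le>
      expectation (\<lambda>x. indicator {x \<in> space M. A x = 1} x * X x)"
  shows "mean_given M A 0 X \<le> expectation X \<and> expectation X \<le> mean_given M A 1 X"
proof -
  let ?S = "\<lambda>a. {x \<in> space M. A x = a}"
  have S0: "?S 0 = space M - ?S 1" using bin by fastforce
  have P0: "prob (?S 0) = 1 - prob (?S 1)" unfolding S0 by (intro prob_compl) simp
  have "expectation X * prob (?S 0) = expectation X - prob (?S 1) * expectation X"
    unfolding P0 by (simp add: algebra_simps)
  moreover have "expectation (\<lambda>x. indicator (?S 0) x * X x) =
      expectation X - expectation (\<lambda>x. indicator (?S 1) x * X x)"
  proof -
    have "expectation (\<lambda>x. indicator (?S 0) x * X x) = expectation (\<lambda>x. X x - indicator (?S 1) x * X x)"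
      using bin by (intro Bochner_Integration.integral_cong) (auto simp: indicator_def)
    also have "\<dots> = expectation X - expectation (\<lambda>x. indicator (?S 1) x * X x)"
      using X integrable_real_mult_indicator[OF _ X, of "?S 1"]
      by (intro Bochner_Integration.integral_diff) (simp_all add: mult.commute)
    finally show ?thesis .
  qed
  ultimately show ?thesis
    using X le pos[of 0] pos[of 1]
    by (simp add: mean_given_eq pos_le_divide_eq pos_divide_le_eq mult.commute)
qed

end


theorem theorem1:
  fixes M :: "'w measure"
    and A Z U Y Y1 Y0 :: "'w \<Rightarrow> real"
    and \<mu> :: "real \<Rightarrow> real \<Rightarrow> real"
  assumes "prob_space M"
    and "A \<in> borel_measurable M" "Z \<in> borel_measurable M" "U \<in> borel_measurable M"
    and "\<And>\<omega>. \<omega> \<in> space M \<Longrightarrow> A \<omega> \<in> {0, 1}"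
    and "integrable M Y1" "integrable M Y0"
    and "\<And>\<omega>. \<omega> \<in> space M \<Longrightarrow> Y \<omega> = A \<omega> * Y1 \<omega> + (1 - A \<omega>) * Y0 \<omega>"
    and "prob_space.indep_var M borel Z borel U"
    and "cond_indep_var M Z Y (\<lambda>\<omega>. (A \<omega>, U \<omega>))"
    and "\<not> prob_space.indep_var M borel Z borel A"
    and "cond_indep_var M A Y1 U" "cond_indep_var M A Y0 U"
    and "AE \<omega> in M. 0 < real_cond_exp M (sigma_of M Z) (treated M A) \<omega> \<and>
                     real_cond_exp M (sigma_of M Z) (treated M A) \<omega> < 1"
    and "AE \<omega> in M. 0 < real_cond_exp M (sigma_of M U) (treated M A) \<omega> \<and>
                     real_cond_exp M (sigma_of M U) (treated M A) \<omega> < 1"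
    and "cond_exp_version M Y (\<lambda>\<omega>. (A \<omega>, Z \<omega>)) (\<lambda>(a, z). \<mu> a z)"
    and "\<And>a. a \<in> {0, 1} \<Longrightarrow> integrable (distr M borel Z) (\<mu> a)"
    and "\<exists>p. cond_exp_version M (treated M A) Z p \<and> nondecreasing_in M Z p"
    and "\<exists>p. cond_exp_version M (treated M A) U p \<and> nondecreasing_in M U p"
    and "\<exists>m. cond_exp_version M Y (\<lambda>\<omega>. (A \<omega>, U \<omega>)) (\<lambda>(a, u). m a u) \<and>
             (\<forall>a\<in>{0, 1}. nondecreasing_in M U (m a))"
    and "\<exists>m. cond_exp_version M Y (\<lambda>\<omega>. (A \<omega>, Z \<omega>)) (\<lambda>(a, z). m a z) \<and>
             (\<forall>a\<in>{0, 1}. nonincreasing_in M Z (m a))"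
  shows "(ACE1_adj M A Z Y \<mu> \<ge> ACE_unadj M A Y \<and> ACE_unadj M A Y \<ge> ACE1_true M A Y1 Y0) \<and>
         (ACE0_adj M A Z Y \<mu> \<ge> ACE_unadj M A Y \<and> ACE_unadj M A Y \<ge> ACE0_true M A Y1 Y0) \<and>
         (ACE_adj M Z \<mu> \<ge> ACE_unadj M A Y \<and> ACE_unadj M A Y \<ge> ACE_true M Y1 Y0)"
proof -

  \<comment> \<open>Strata, integrability of the outcome, and overlap in both arms\<close>
  interpret prob_space M by fact
  note [measurable] = \<open>A \<in> borel_measurable M\<close> \<open>Z \<in> borel_measurable M\<close> \<open>U \<in> borel_measurable M\<close>
  note bin = \<open>\<And>\<omega>. \<omega> \<in> space M \<Longrightarrow> A \<omega> \<in> {0, 1}\<close>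
  note Y_eq = \<open>\<And>\<omega>. \<omega> \<in> space M \<Longrightarrow> Y \<omega> = A \<omega> * Y1 \<omega> + (1 - A \<omega>) * Y0 \<omega>\<close>
  define S where "S a = {\<omega> \<in> space M. A \<omega> = a}" for a
  have S[measurable]: "S a \<in> sets M" for a by (simp add: S_def)
  have S0: "S 0 = space M - S 1" using bin by (fastforce simp: S_def)
  have treated: "treated M A = indicator (S 1)" by (simp add: treated_def S_def)
  \<comment> \<open>Indexing the potential outcomes by the arm lets one argument serve both.\<close>
  define Ya where "Ya a = (if a = 1 then Y1 else Y0)" for a :: real
  have Ya: "integrable M (Ya a)" for a using assms(6,7) by (simp add: Ya_def)
  have SYa: "indicator (S a) \<omega> * Y \<omega> = indicator (S a) \<omega> * Ya a \<omega>"
    if "a \<in> {0, 1}" "\<omega> \<in> space M" for a \<omega>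
    using that Y_eq by (auto simp: S_def Ya_def indicator_def)
  have intS: "integrable M (\<lambda>\<omega>. indicator (S a) \<omega> * X \<omega>)" if "integrable M X" for a and X :: "'w \<Rightarrow> real"
    using integrable_real_mult_indicator[OF S that] by (simp add: mult.commute)
  \<comment> \<open>On \<open>space M\<close> this sum is \<open>Y\<close>, since exactly one of the
    two indicators is 1.\<close>
  have "integrable M (\<lambda>\<omega>. indicator (S 1) \<omega> * Ya 1 \<omega> + indicator (S 0) \<omega> * Ya 0 \<omega>)"
    by (intro Bochner_Integration.integrable_add intS Ya)
  then have Y: "integrable M Y"
    by (rule Bochner_Integration.integrable_cong[THEN iffD1, rotated -1])
      (use bin Y_eq in \<open>force simp: S_def Ya_def indicator_def\<close>)+
  have subZ: "finite_measure_subalgebra M (sigma_of M Z)"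
    and subU: "finite_measure_subalgebra M (sigma_of M U)"
    by (rule finite_measure_subalgebra_sigma_of; simp)+
  interpret FZ: finite_measure_subalgebra M "sigma_of M Z" by (fact subZ)
  interpret FU: finite_measure_subalgebra M "sigma_of M U" by (fact subU)
  have overlap: "AE \<omega> in M. 0 < real_cond_exp M F (indicator (S a)) \<omega>"
    if F: "finite_measure_subalgebra M F" "AE \<omega> in M. 0 < real_cond_exp M F (treated M A) \<omega> \<and>
        real_cond_exp M F (treated M A) \<omega> < 1" and a: "a \<in> {0, 1}" for F a
  proof (cases "a = 1")
    case True
    show ?thesis using F(2) by eventually_elim (simp add: True treated)
  next
    case False
    have "AE \<omega> in M. real_cond_exp M F (indicator (S 1)) \<omega> < 1"
      using F(2) by eventually_elim (simp add: treated)
    from real_cond_exp_compl_pos[OF F(1) S this] show ?thesis using False a by (simp add: S0)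
  qed
  note overlapZ = overlap[OF subZ assms(14)] and overlapU = overlap[OF subU assms(15)]
  have pos: "0 < prob {\<omega> \<in> space M. A \<omega> = a}" if "a \<in> {0, 1}" for a
    using prob_pos_if_real_cond_exp_pos[OF subU S overlapU[OF that]] by (simp add: S_def)

  \<comment> \<open>Potential outcomes compared across the arms through \<open>U\<close>\<close>
  have true: "mean_given M A 0 (Ya a) \<le> expectation (Ya a) \<and> expectation (Ya a) \<le> mean_given M A 1 (Ya a)"
    if a: "a \<in> {0, 1}" for a
  proof -
    obtain p where p: "cond_exp_version M (indicator (S 1)) U p" "nondecreasing_in M U p"
      using assms(19) by (auto simp: treated)
    obtain m where m: "cond_exp_version M Y (\<lambda>\<omega>. (A \<omega>, U \<omega>)) (\<lambda>(a, u). m a u)"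
      "nondecreasing_in M U (m a)" using assms(20) a by blast
    have ind: "cond_indep_var M A (Ya a) U" using assms(12,13) by (simp add: Ya_def)
    \<comment> \<open>Two values of \<open>b\<close> matter: \<open>b = a\<close> identifies the
      regression \<open>m a\<close>, and \<open>b = 1\<close> enters the covariance
      inequality.\<close>
    have fact: "AE \<omega> in M. real_cond_exp M (sigma_of M U) (\<lambda>\<omega>. indicator (S b) \<omega> * Ya a \<omega>) \<omega> =
        real_cond_exp M (sigma_of M U) (indicator (S b)) \<omega> * real_cond_exp M (sigma_of M U) (Ya a) \<omega>" for b
      using cond_indep_var_real_cond_exp_mult[OF ind Ya, of "{b}"] by (simp add: S_def)
    have "AE \<omega> in M. real_cond_exp M (sigma_of M U) (\<lambda>\<omega>. indicator (S a) \<omega> * Y \<omega>) \<omega> =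
        real_cond_exp M (sigma_of M U) (\<lambda>\<omega>. indicator (S a) \<omega> * Ya a \<omega>) \<omega>"
      using Y Ya SYa[OF a] by (intro FU.real_cond_exp_cong) auto
    \<comment> \<open>Both sides times pr(A = a | U) equal the conditional expectation of
      \<open>Y\<close> restricted to \<open>S a\<close>; overlap allows cancelling that
      factor.\<close>
    then have "AE \<omega> in M. m a (U \<omega>) = real_cond_exp M (sigma_of M U) (Ya a) \<omega>"
      using fact[of a] overlapU[OF a] real_cond_exp_stratum(3)[OF _ _ Y m(1), of a, folded S_def, simplified]
      by eventually_elim simp
    then have g: "cond_exp_version M (Ya a) U (m a)"
      using cond_exp_version_stratum_measurable[OF m(1)] by (simp add: cond_exp_version_def)
    show ?thesis
      using prob_mult_expectation_le[OF _ S Ya fact p g m(2)]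
      by (intro mean_given_le_expectation_le_mean_given bin pos Ya) (simp_all add: S_def)
  qed

  \<comment> \<open>Adjusted regressions compared across the arms through \<open>Z\<close>\<close>
  have adj: "mean_given M A 1 (\<lambda>\<omega>. \<mu> a (Z \<omega>)) \<le> expectation (\<lambda>\<omega>. \<mu> a (Z \<omega>)) \<and>
      expectation (\<lambda>\<omega>. \<mu> a (Z \<omega>)) \<le> mean_given M A 0 (\<lambda>\<omega>. \<mu> a (Z \<omega>))"
    and mean_Y: "mean_given M A a Y = mean_given M A a (\<lambda>\<omega>. \<mu> a (Z \<omega>))"
    and meas_\<mu>: "\<mu> a \<in> borel_measurable borel"
    if a: "a \<in> {0, 1}" for a
  proof -
    show [measurable]: "\<mu> a \<in> borel_measurable borel"
      by (rule cond_exp_version_stratum_measurable[OF assms(16)])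
    have int: "integrable M (\<lambda>\<omega>. \<mu> a (Z \<omega>))"
      using assms(17)[OF a] by (simp add: integrable_distr_eq)
    obtain p where p: "cond_exp_version M (indicator (S 1)) Z p" "nondecreasing_in M Z p"
      using assms(18) by (auto simp: treated)
    obtain m where m: "cond_exp_version M Y (\<lambda>\<omega>. (A \<omega>, Z \<omega>)) (\<lambda>(a, u). m a u)"
      "nonincreasing_in M Z (m a)" using assms(21) a by blast
    \<comment> \<open>The sign change turns the non-increasing regression into a non-decreasing one,
      so the same covariance inequality applies.\<close>
    define X where "X = (\<lambda>\<omega>. - \<mu> a (Z \<omega>))"
    have X: "integrable M X" using int by (simp add: X_def)
    have XF: "X \<in> borel_measurable (sigma_of M Z)"
      unfolding X_def by (intro borel_measurable_uminus measurable_compose[OF measurable_sigma_of]) simp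
    have X_ce: "AE \<omega> in M. real_cond_exp M (sigma_of M Z) X \<omega> = X \<omega>"
      using X XF by (intro FZ.real_cond_exp_F_meas) auto
    have "AE \<omega> in M. real_cond_exp M (sigma_of M Z) (\<lambda>\<omega>. X \<omega> * indicator (S 1) \<omega>) \<omega> =
        X \<omega> * real_cond_exp M (sigma_of M Z) (indicator (S 1)) \<omega>"
      using XF intS[OF X] by (intro FZ.real_cond_exp_mult) (auto simp: mult.commute)
    then have fact: "AE \<omega> in M. real_cond_exp M (sigma_of M Z) (\<lambda>\<omega>. indicator (S 1) \<omega> * X \<omega>) \<omega> =
        real_cond_exp M (sigma_of M Z) (indicator (S 1)) \<omega> * real_cond_exp M (sigma_of M Z) X \<omega>"
      using X_ce by eventually_elim (simp add: mult.commute)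
    \<comment> \<open>\<open>\<mu>\<close> is an arbitrary version and \<open>m\<close> the monotone
      one. Both satisfy the stratum identity with the same positive factor pr(A = a | Z), so they
      agree at \<open>Z\<close> almost surely.\<close>
    have "AE \<omega> in M. m a (Z \<omega>) = \<mu> a (Z \<omega>)"
      using overlapZ[OF a] real_cond_exp_stratum(3)[OF _ _ Y m(1), of a, folded S_def, simplified]
        real_cond_exp_stratum(3)[OF _ _ Y assms(16), of a, folded S_def, simplified]
      by eventually_elim simp
    then have "AE \<omega> in M. - m a (Z \<omega>) = real_cond_exp M (sigma_of M Z) X \<omega>"
      using X_ce by eventually_elim (simp add: X_def)
    then have g: "cond_exp_version M X Z (\<lambda>z. - m a z)"
      using cond_exp_version_stratum_measurable[OF m(1)] by (simp add: cond_exp_version_def)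
    have g_mono: "nondecreasing_in M Z (\<lambda>z. - m a z)"
      using m(2) by (auto simp: nondecreasing_in_def nonincreasing_in_def monotone_on_def)
    have "mean_given M A 0 X \<le> expectation X \<and> expectation X \<le> mean_given M A 1 X"
      using prob_mult_expectation_le[OF _ S X fact p g g_mono]
      by (intro mean_given_le_expectation_le_mean_given bin pos X) (simp_all add: S_def)
    then show "mean_given M A 1 (\<lambda>\<omega>. \<mu> a (Z \<omega>)) \<le> expectation (\<lambda>\<omega>. \<mu> a (Z \<omega>)) \<and>
      expectation (\<lambda>\<omega>. \<mu> a (Z \<omega>)) \<le> mean_given M A 0 (\<lambda>\<omega>. \<mu> a (Z \<omega>))"
      by (simp add: X_def mean_given_def)
    show "mean_given M A a Y = mean_given M A a (\<lambda>\<omega>. \<mu> a (Z \<omega>))"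
      using Y real_cond_exp_stratum(2)[OF _ _ Y assms(16), of a] by (simp add: mean_given_eq)
  qed

  \<comment> \<open>Assembling the six inequalities\<close>
  have obs: "mean_given M A a Y = mean_given M A a (Ya a)" if "a \<in> {0, 1}" for a
    using Bochner_Integration.integral_cong[OF refl SYa[OF that], of M] Y Ya
    by (simp add: mean_given_eq S_def)
  have "(\<integral>z. \<mu> a z \<partial>distr N borel Z) = (\<integral>\<omega>. \<mu> a (Z \<omega>) \<partial>N)"
    if "a \<in> {0, 1}" "sets N = sets M" for a N
    using meas_\<mu>[OF that(1)] that(2) by (intro integral_distr) (simp_all cong: measurable_cong_sets)
  moreover have "sets (given M A a) = sets M" for a by (simp add: given_def)
  \<comment> \<open>The effect on the treated involves the comparison for \<open>a = 0\<close>
    alone, that on the untreated the one for \<open>a = 1\<close> alone. The overall effect adds,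
    over both arms, the gaps between overall and stratum means.\<close>
  ultimately show ?thesis
    using true[of 0] true[of 1] adj[of 0] adj[of 1] mean_Y[of 0] mean_Y[of 1] obs[of 0] obs[of 1]
    unfolding ACE1_adj_def ACE0_adj_def ACE_adj_def ACE_unadj_def ACE1_true_def ACE0_true_def ACE_true_def
    by (simp add: Ya_def mean_given_def)
qed

end
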